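(* Let $(M^{2n+1},\theta,\xi,\eta,g)$ be a nearly cosymplectic manifold. Then for any $X$ in $\mathcal F$ we have $$\sum_{i=1}^{2n+1}\sum_{j=1}^{2n}g\big((\bar\nabla_{E_i}J)(F_j),[R(E_i,X),\theta]F_j\big)=0,$$ where $\{F_i\}_{i=1,\dots,2n}$ is an orthonormal basis of $\mathcal F$ and $\{E_i\}_{i=1,\dots,2n+1}=\{F_i\}_{i=1,\dots,2n}\cup\{\xi\}$.
   Context: An almost contact (metric) structure on a Riemannian manifold $(M^{2n+1},g)$ consists of a $(1,1)$-tensor $\theta$, a 1-form $\eta$ and a unit vector field $\xi$ with $\theta^2=-\mathrm{Id}+\eta\otimes\xi$, $\eta(\xi)=1$, compatible with the metric: $g(\theta X,\theta Y)=g(X,Y)-\eta(X)\eta(Y)$ (so $\eta=g(\xi,\cdot)$, $\theta\xi=0$ and $\theta$ is skew-symmetric). It is nearly cosymplectic, and $(M,\theta,\xi,\eta,g)$ is a nearly cosymplectic manifold, if $(\nabla_X\theta)(Y)+(\nabla_Y\theta)(X)=0$ for all $X,Y$, where $\nabla$ is the Levi-Civita connection of $g$. $\mathcal F$ is the distribution orthogonal to $\xi$ (rank $2n$), $J$ is the restriction of $\theta$ to $\mathcal F$, and $\bar\nabla$ is the connection on $\mathcal F$ obtained by projecting $\nabla$ orthogonally onto $\mathcal F$; $(\bar\nabla_XJ)(Y)=\bar\nabla_X(JY)-J\bar\nabla_XY$ for $X\in TM$ and $Y$ a section of $\mathcal F$. The curvature is $R(X,Y)=[\nabla_X,\nabla_Y]-\nabla_{[X,Y]}$,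 and $[R(X,Y),\theta]=R(X,Y)\circ\theta-\theta\circ R(X,Y)$. *)

theory Defs
  imports "HOL-Analysis.Analysis" "HOL-Library.Function_Algebras" "HOL-Library.FuncSet"
begin

section \<open>Smooth manifolds\<close>

text \<open>
  A manifold is a Hausdorff, second countable topological type \<open>'m\<close> with a smooth atlas modelled
  on a Euclidean space \<open>'e\<close>; its dimension is \<open>DIM('e)\<close>.
\<close>

primrec Ck_on :: "nat \<Rightarrow> 'a::real_normed_vector set \<Rightarrow> ('a \<Rightarrow> 'b::real_normed_vector) \<Rightarrow> bool"
  where
    "Ck_on 0 S f \<longleftrightarrow> continuous_on S f"
  | "Ck_on (Suc k) S f \<longleftrightarrow>
       (\<forall>x\<in>S. f differentiable (at x)) \<and>
       (\<forall>v. Ck_on k S (\<lambda>x. frechet_derivative f (at x) v))"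

text \<open>\<^const>\<open>Ck_on\<close> is only used on open sets.\<close>

definition smooth_on :: "'a::real_normed_vector set \<Rightarrow> ('a \<Rightarrow> 'b::real_normed_vector) \<Rightarrow> bool"
  where "smooth_on S f \<longleftrightarrow> (\<forall>k. Ck_on k S f)"

type_synonym ('m, 'e) atlas = "('m set \<times> ('m \<Rightarrow> 'e)) set"

definition chart :: "'m::topological_space set \<Rightarrow> ('m \<Rightarrow> 'e::euclidean_space) \<Rightarrow> bool"
  where "chart U \<phi> \<longleftrightarrow>
    open U \<and> open (\<phi> ` U) \<and> homeomorphism U (\<phi> ` U) \<phi> (inv_into U \<phi>)"

definition smooth_atlas ::
    "('m::{t2_space, second_countable_topology}, 'e::euclidean_space) atlas \<Rightarrow> bool"
  where "smooth_atlas A \<longleftrightarrow>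
    (\<forall>(U, \<phi>)\<in>A. chart U \<phi>) \<and>
    (\<Union>(U, \<phi>)\<in>A. U) = UNIV \<and>
    (\<forall>(U, \<phi>)\<in>A. \<forall>(V, \<psi>)\<in>A. smooth_on (\<phi> ` (U \<inter> V)) (\<psi> \<circ> inv_into U \<phi>))"

definition smooth_functions :: "('m, 'e::euclidean_space) atlas \<Rightarrow> ('m \<Rightarrow> real) set"
  where "smooth_functions A = {f. \<forall>(U, \<phi>)\<in>A. smooth_on (\<phi> ` U) (f \<circ> inv_into U \<phi>)}"


section \<open>Tangent vectors and vector fields\<close>

text \<open>
  A tangent vector at \<open>p\<close> is a derivation at \<open>p\<close> of the algebra of smooth functions on the
  manifold.  Its value on non-smooth functions is fixed to be 0, so that equality of tangent
  vectors in HOL is equality of derivations.  Sums, differences and 0 of tangent vectors and of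
  vector fields are the pointwise ones of \<open>Function_Algebras\<close>.
\<close>

type_synonym 'm tvec = "('m \<Rightarrow> real) \<Rightarrow> real"
type_synonym 'm vfield = "'m \<Rightarrow> 'm tvec"

definition tangent_space :: "('m, 'e::euclidean_space) atlas \<Rightarrow> 'm \<Rightarrow> 'm tvec set"
  where "tangent_space A p = {v.
    (\<forall>f\<in>smooth_functions A. \<forall>h\<in>smooth_functions A.
        v (\<lambda>q. f q + h q) = v f + v h \<and>
        v (\<lambda>q. f q * h q) = f p * v h + h p * v f) \<and>
    (\<forall>c. \<forall>f\<in>smooth_functions A. v (\<lambda>q. c * f q) = c * v f) \<and>
    (\<forall>f. f \<notin> smooth_functions A \<longrightarrow> v f = 0)}"

definition scale_tv :: "real \<Rightarrow> 'm tvec \<Rightarrow> 'm tvec"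
  where "scale_tv c v = (\<lambda>f. c * v f)"

definition scale_vf :: "('m \<Rightarrow> real) \<Rightarrow> 'm vfield \<Rightarrow> 'm vfield"
  where "scale_vf f X = (\<lambda>p. scale_tv (f p) (X p))"

definition deriv_along :: "'m vfield \<Rightarrow> ('m \<Rightarrow> real) \<Rightarrow> 'm \<Rightarrow> real"
  where "deriv_along X f = (\<lambda>p. X p f)"

definition vector_field :: "('m, 'e::euclidean_space) atlas \<Rightarrow> 'm vfield \<Rightarrow> bool"
  where "vector_field A X \<longleftrightarrow>
    (\<forall>p. X p \<in> tangent_space A p) \<and>
    (\<forall>f\<in>smooth_functions A. deriv_along X f \<in> smooth_functions A)"

definition lie_bracket :: "'m vfield \<Rightarrow> 'm vfield \<Rightarrow> 'm vfield"
  where "lie_bracket X Y = (\<lambda>p f. X p (deriv_along Y f) - Y p (deriv_along X f))"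


section \<open>Tensor fields\<close>

type_synonym 'm oneform = "'m \<Rightarrow> 'm tvec \<Rightarrow> real"
type_synonym 'm endo = "'m \<Rightarrow> 'm tvec \<Rightarrow> 'm tvec"
type_synonym 'm bilin = "'m \<Rightarrow> 'm tvec \<Rightarrow> 'm tvec \<Rightarrow> real"

text \<open>
  A tensor field is a family of multilinear maps on the tangent spaces; it is smooth if it sends
  (smooth) vector fields to smooth functions or vector fields.
\<close>

definition one_form :: "('m, 'e::euclidean_space) atlas \<Rightarrow> 'm oneform \<Rightarrow> bool"
  where "one_form A \<eta> \<longleftrightarrow>
    (\<forall>p. \<forall>u\<in>tangent_space A p. \<forall>v\<in>tangent_space A p. \<eta> p (u + v) = \<eta> p u + \<eta> p v) \<and>
    (\<forall>p c. \<forall>v\<in>tangent_space A p. \<eta> p (scale_tv c v) = c * \<eta> p v) \<and>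
    (\<forall>X. vector_field A X \<longrightarrow> (\<lambda>p. \<eta> p (X p)) \<in> smooth_functions A)"

definition apply_endo :: "'m endo \<Rightarrow> 'm vfield \<Rightarrow> 'm vfield"
  where "apply_endo \<theta> X = (\<lambda>p. \<theta> p (X p))"

definition endo_field :: "('m, 'e::euclidean_space) atlas \<Rightarrow> 'm endo \<Rightarrow> bool"
  where "endo_field A \<theta> \<longleftrightarrow>
    (\<forall>p. \<forall>v\<in>tangent_space A p. \<theta> p v \<in> tangent_space A p) \<and>
    (\<forall>p. \<forall>u\<in>tangent_space A p. \<forall>v\<in>tangent_space A p. \<theta> p (u + v) = \<theta> p u + \<theta> p v) \<and>
    (\<forall>p c. \<forall>v\<in>tangent_space A p. \<theta> p (scale_tv c v) = scale_tv c (\<theta> p v)) \<and>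
    (\<forall>X. vector_field A X \<longrightarrow> vector_field A (apply_endo \<theta> X))"

definition riemannian_metric :: "('m, 'e::euclidean_space) atlas \<Rightarrow> 'm bilin \<Rightarrow> bool"
  where "riemannian_metric A g \<longleftrightarrow>
    (\<forall>p. \<forall>u\<in>tangent_space A p. \<forall>v\<in>tangent_space A p.
        g p u v = g p v u \<and> (\<forall>c. g p (scale_tv c u) v = c * g p u v)) \<and>
    (\<forall>p. \<forall>u\<in>tangent_space A p. \<forall>v\<in>tangent_space A p. \<forall>w\<in>tangent_space A p.
        g p (u + v) w = g p u w + g p v w) \<and>
    (\<forall>p. \<forall>v\<in>tangent_space A p. v \<noteq> 0 \<longrightarrow> g p v v > 0) \<and>
    (\<forall>X Y. vector_field A X \<longrightarrow> vector_field A Y \<longrightarrow>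
        (\<lambda>p. g p (X p) (Y p)) \<in> smooth_functions A)"


section \<open>Connections and curvature\<close>

type_synonym 'm connection = "'m vfield \<Rightarrow> 'm vfield \<Rightarrow> 'm vfield"

text \<open>\<open>D X Y\<close> is the covariant derivative of \<open>Y\<close> in direction \<open>X\<close>.\<close>

definition affine_connection :: "('m, 'e::euclidean_space) atlas \<Rightarrow> 'm connection \<Rightarrow> bool"
  where "affine_connection A D \<longleftrightarrow>
    (\<forall>X Y. vector_field A X \<longrightarrow> vector_field A Y \<longrightarrow> vector_field A (D X Y)) \<and>
    (\<forall>X X' Y. vector_field A X \<longrightarrow> vector_field A X' \<longrightarrow> vector_field A Y \<longrightarrow>
        D (X + X') Y = D X Y + D X' Y) \<and>
    (\<forall>X Y Y'. vector_field A X \<longrightarrow> vector_field A Y \<longrightarrow> vector_field A Y' \<longrightarrow>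
        D X (Y + Y') = D X Y + D X Y') \<and>
    (\<forall>f X Y. f \<in> smooth_functions A \<longrightarrow> vector_field A X \<longrightarrow> vector_field A Y \<longrightarrow>
        D (scale_vf f X) Y = scale_vf f (D X Y) \<and>
        D X (scale_vf f Y) = scale_vf (deriv_along X f) Y + scale_vf f (D X Y))"

definition levi_civita ::
    "('m, 'e::euclidean_space) atlas \<Rightarrow> 'm bilin \<Rightarrow> 'm connection \<Rightarrow> bool"
  where "levi_civita A g D \<longleftrightarrow>
    affine_connection A D \<and>
    (\<forall>X Y. vector_field A X \<longrightarrow> vector_field A Y \<longrightarrow> D X Y - D Y X = lie_bracket X Y) \<and>
    (\<forall>X Y Z. vector_field A X \<longrightarrow> vector_field A Y \<longrightarrow> vector_field A Z \<longrightarrow>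
        deriv_along X (\<lambda>p. g p (Y p) (Z p)) =
          (\<lambda>p. g p (D X Y p) (Z p) + g p (Y p) (D X Z p)))"

definition curvature :: "'m connection \<Rightarrow> 'm vfield \<Rightarrow> 'm vfield \<Rightarrow> 'm vfield \<Rightarrow> 'm vfield"
  where "curvature D X Y Z = D X (D Y Z) - D Y (D X Z) - D (lie_bracket X Y) Z"

definition cov_deriv_endo :: "'m connection \<Rightarrow> 'm endo \<Rightarrow> 'm vfield \<Rightarrow> 'm vfield \<Rightarrow> 'm vfield"
  where "cov_deriv_endo D \<theta> X Y = D X (apply_endo \<theta> Y) - apply_endo \<theta> (D X Y)"

text \<open>The value of the commutator of the curvature operator \<open>R(X,Y)\<close> and \<open>\<theta>\<close> on \<open>Z\<close>.\<close>

definition curvature_commutator ::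
    "'m connection \<Rightarrow> 'm endo \<Rightarrow> 'm vfield \<Rightarrow> 'm vfield \<Rightarrow> 'm vfield \<Rightarrow> 'm vfield"
  where "curvature_commutator D \<theta> X Y Z =
    curvature D X Y (apply_endo \<theta> Z) - apply_endo \<theta> (curvature D X Y Z)"


section \<open>Nearly cosymplectic manifolds\<close>

definition almost_contact_metric ::
    "('m, 'e::euclidean_space) atlas \<Rightarrow> 'm endo \<Rightarrow> 'm vfield \<Rightarrow> 'm oneform \<Rightarrow> 'm bilin \<Rightarrow> bool"
  where "almost_contact_metric A \<theta> \<xi> \<eta> g \<longleftrightarrow>
    endo_field A \<theta> \<and> vector_field A \<xi> \<and> one_form A \<eta> \<and>
    (\<forall>p. g p (\<xi> p) (\<xi> p) = 1) \<and>
    (\<forall>p. \<eta> p (\<xi> p) = 1) \<and>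
    (\<forall>p. \<forall>v\<in>tangent_space A p. \<theta> p (\<theta> p v) = - v + scale_tv (\<eta> p v) (\<xi> p)) \<and>
    (\<forall>p. \<forall>u\<in>tangent_space A p. \<forall>v\<in>tangent_space A p.
        g p (\<theta> p u) (\<theta> p v) = g p u v - \<eta> p u * \<eta> p v)"

definition nearly_cosymplectic_manifold ::
    "('m::{t2_space, second_countable_topology}, 'e::euclidean_space) atlas \<Rightarrow>
      'm endo \<Rightarrow> 'm vfield \<Rightarrow> 'm oneform \<Rightarrow> 'm bilin \<Rightarrow> 'm connection \<Rightarrow> bool"
  where "nearly_cosymplectic_manifold A \<theta> \<xi> \<eta> g D \<longleftrightarrow>
    smooth_atlas A \<and> riemannian_metric A g \<and> levi_civita A g D \<and>
    almost_contact_metric A \<theta> \<xi> \<eta> g \<and>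
    (\<forall>X Y. vector_field A X \<longrightarrow> vector_field A Y \<longrightarrow>
        cov_deriv_endo D \<theta> X Y + cov_deriv_endo D \<theta> Y X = 0)"


section \<open>The distribution orthogonal to \<open>\<xi>\<close>\<close>

definition orth_distribution ::
    "('m, 'e::euclidean_space) atlas \<Rightarrow> 'm bilin \<Rightarrow> 'm vfield \<Rightarrow> 'm \<Rightarrow> 'm tvec set"
  where "orth_distribution A g \<xi> p = {v \<in> tangent_space A p. g p (\<xi> p) v = 0}"

definition orth_section ::
    "('m, 'e::euclidean_space) atlas \<Rightarrow> 'm bilin \<Rightarrow> 'm vfield \<Rightarrow> 'm vfield \<Rightarrow> bool"
  where "orth_section A g \<xi> Y \<longleftrightarrow>
    vector_field A Y \<and> (\<forall>p. Y p \<in> orth_distribution A g \<xi> p)"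

text \<open>\<open>restr_endo A g \<xi> \<theta>\<close> is \<open>J\<close>; it is undefined off the distribution.\<close>

definition restr_endo ::
    "('m, 'e::euclidean_space) atlas \<Rightarrow> 'm bilin \<Rightarrow> 'm vfield \<Rightarrow> 'm endo \<Rightarrow> 'm endo"
  where "restr_endo A g \<xi> \<theta> = (\<lambda>p. restrict (\<theta> p) (orth_distribution A g \<xi> p))"

text \<open>
  The projected connection: \<open>v \<mapsto> v - g(\<xi>, v) \<xi>\<close> is the orthogonal projection onto the
  distribution, as \<open>\<xi>\<close> is a unit vector field.
\<close>

definition proj_connection :: "'m bilin \<Rightarrow> 'm vfield \<Rightarrow> 'm connection \<Rightarrow> 'm connection"
  where "proj_connection g \<xi> D X Y = (\<lambda>p. D X Y p - scale_tv (g p (\<xi> p) (D X Y p)) (\<xi> p))"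

text \<open>
  An orthonormal basis \<open>b 1, \<dots>, b m\<close> of the fibre of the distribution at \<open>p\<close>.  A tensor built from
  covariant derivatives is evaluated on such a basis by extending the basis vectors to global
  sections of the distribution; the sections need not be orthonormal away from \<open>p\<close>.
\<close>

definition orthonormal_basis_at ::
    "('m, 'e::euclidean_space) atlas \<Rightarrow> 'm bilin \<Rightarrow> 'm vfield \<Rightarrow> 'm \<Rightarrow> nat \<Rightarrow> (nat \<Rightarrow> 'm tvec) \<Rightarrow> bool"
  where "orthonormal_basis_at A g \<xi> p m b \<longleftrightarrow>
    (\<forall>i\<in>{1..m}. b i \<in> orth_distribution A g \<xi> p) \<and>
    (\<forall>i\<in>{1..m}. \<forall>j\<in>{1..m}. g p (b i) (b j) = (if i = j then 1 else 0)) \<and>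
    (\<forall>v\<in>orth_distribution A g \<xi> p. \<exists>c. v = (\<Sum>i=1..m. scale_tv (c i) (b i)))"

end

theory Submission
  imports Defs
begin

text \<open>
  Write \<open>\<Psi>(X,Y,Z) = g((\<nabla>\<^sub>X \<theta>)Y, Z)\<close>, a 3-form, and \<open>R(X,Y,Z,W) = g(R(X,Y)Z, W)\<close>.  The sum is
  \<open>\<Sum> \<Psi>(E\<^sub>i,F\<^sub>j,F\<^sub>k) (R(E\<^sub>i,X,\<theta>F\<^sub>j,F\<^sub>k) + R(E\<^sub>i,X,F\<^sub>j,\<theta>F\<^sub>k))\<close>.

  For \<open>E\<^sub>i = \<xi>\<close> every term vanishes, because \<open>R(\<xi>,X,Y,Z) = 0\<close> on the distribution.  This follows
  from the Bianchi identity once \<open>R(\<xi>,Z,\<theta>Z,X) = 0\<close>, which comes from comparing the Ricci identity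
  for \<open>\<theta>\<close> with the derivative of \<open>\<nabla>\<^sub>\<xi> \<theta> = \<theta> \<circ> \<nabla>\<xi>\<close>, as \<open>\<xi>\<close> is Killing.

  For \<open>E\<^sub>i = F\<^sub>i\<close>, expanding \<open>\<theta>F\<^sub>j\<close> in the basis turns the sum into
  \<open>-2 \<Sum> \<Psi>(F\<^sub>i,\<theta>F\<^sub>j,F\<^sub>k) R(F\<^sub>i,X,F\<^sub>j,F\<^sub>k)\<close>.  On the distribution \<open>\<Psi>(\<cdot>,\<theta>\<cdot>,\<cdot>)\<close> is invariant under
  cyclic permutations, so the Bianchi identity makes it vanish.

  All tensors involved are skew-symmetric in enough arguments for their values to depend
  pointwise on each argument, so no bump functions are needed.
\<close>

section \<open>Smooth functions and vector fields\<close>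

text \<open>Since \<open>S\<close> is open, derivatives at its points see only values on
  \<open>S\<close>. The induction passes from the functions to their directional derivatives, hence
  the generalisation over \<open>f\<close> and \<open>g\<close>.\<close>

lemma Ck_on_cong:
  assumes "open S" "\<And>x. x \<in> S \<Longrightarrow> f x = g x" "Ck_on k S f"
  shows "Ck_on k S g"
  using assms(2,3)
proof (induction k arbitrary: f g)
  case 0
  then show ?case by (simp cong: continuous_on_cong)
next
  case (Suc k)
  have d: "(g has_derivative f') (at x) \<longleftrightarrow> (f has_derivative f') (at x)" if "x \<in> S" for f' x
    using Suc.prems(1) that assms(1) by (metis has_derivative_transform_within_open)
  have "g differentiable (at x)" if "x \<in> S" for x
    using Suc.prems(2) that d by (auto simp: differentiable_def)
  moreover have "Ck_on k S (\<lambda>x. frechet_derivative g (at x) v)" for v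
  proof (rule Suc.IH)
    show "Ck_on k S (\<lambda>x. frechet_derivative f (at x) v)" using Suc.prems(2) by simp
    show "frechet_derivative f (at x) v = frechet_derivative g (at x) v" if "x \<in> S" for x
      using d[OF that] by (simp add: frechet_derivative_def)
  qed
  ultimately show ?case by simp
qed

lemma Ck_on_lincomb:
  assumes "open S" "Ck_on k S f" "Ck_on k S g"
  shows "Ck_on k S (\<lambda>x. a *\<^sub>R f x + b *\<^sub>R g x)"
  using assms(2,3)
proof (induction k arbitrary: f g)
  case 0
  then show ?case by (auto intro!: continuous_intros)
next
  case (Suc k)
  have d: "((\<lambda>x. a *\<^sub>R f x + b *\<^sub>R g x) has_derivative
      (\<lambda>v. a *\<^sub>R frechet_derivative f (at x) v + b *\<^sub>R frechet_derivative g (at x) v)) (at x)"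
    if "x \<in> S" for x
    using Suc.prems that
    by (auto intro!: derivative_intros simp: frechet_derivative_works[symmetric])
  have "Ck_on k S (\<lambda>x. frechet_derivative (\<lambda>x. a *\<^sub>R f x + b *\<^sub>R g x) (at x) v)" for v
  proof (rule Ck_on_cong[OF assms(1)])
    show "Ck_on k S (\<lambda>x. a *\<^sub>R frechet_derivative f (at x) v + b *\<^sub>R frechet_derivative g (at x) v)"
      using Suc by simp
    show "a *\<^sub>R frechet_derivative f (at x) v + b *\<^sub>R frechet_derivative g (at x) v
        = frechet_derivative (\<lambda>x. a *\<^sub>R f x + b *\<^sub>R g x) (at x) v" if "x \<in> S" for x
      using frechet_derivative_at[OF d[OF that]] by metis
  qed
  then show ?case using d by (auto simp: differentiable_def)
qed

lemma smooth_functions_lincomb: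
  fixes A :: "('m::{t2_space, second_countable_topology}, 'e::euclidean_space) atlas"
  assumes "smooth_atlas A" "f \<in> smooth_functions A" "h \<in> smooth_functions A"
  shows "(\<lambda>q. a * f q + b * h q) \<in> smooth_functions A"
proof -
  have "smooth_on (\<phi> ` U) ((\<lambda>q. a * f q + b * h q) \<circ> inv_into U \<phi>)" if "(U, \<phi>) \<in> A" for U \<phi>
  proof -
    have "open (\<phi> ` U)" using assms(1) that by (auto simp: smooth_atlas_def chart_def)
    moreover have "smooth_on (\<phi> ` U) (f \<circ> inv_into U \<phi>)" "smooth_on (\<phi> ` U) (h \<circ> inv_into U \<phi>)"
      using assms(2,3) that by (auto simp: smooth_functions_def)
    ultimately show ?thesis
      unfolding smooth_on_def using Ck_on_lincomb[of "\<phi> ` U" _ "f \<circ> inv_into U \<phi>" "h \<circ> inv_into U \<phi>" a b]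
      by (simp add: o_def)
  qed
  then show ?thesis by (auto simp: smooth_functions_def)
qed

locale riemannian_manifold =
  fixes A :: "('m::{t2_space, second_countable_topology}, 'e::euclidean_space) atlas"
    and g :: "'m bilin" and D :: "'m connection"
  assumes atlas: "smooth_atlas A" and metric: "riemannian_metric A g"
    and lc: "levi_civita A g D"
begin

abbreviation TM where "TM \<equiv> tangent_space A"
abbreviation VF where "VF \<equiv> vector_field A"
abbreviation C where "C \<equiv> smooth_functions A"

lemma smooth_add: "f \<in> C \<Longrightarrow> h \<in> C \<Longrightarrow> (\<lambda>q. f q + h q) \<in> C"
  using smooth_functions_lincomb[OF atlas, of f h 1 1] by simp

lemma smooth_diff: "f \<in> C \<Longrightarrow> h \<in> C \<Longrightarrow> (\<lambda>q. f q - h q) \<in> C"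
  using smooth_functions_lincomb[OF atlas, of f h 1 "-1"] by simp

lemma smooth_uminus: "f \<in> C \<Longrightarrow> (\<lambda>q. - f q) \<in> C"
  using smooth_functions_lincomb[OF atlas, of f f "-1" 0] by simp

lemma TM_add: "u \<in> TM p \<Longrightarrow> v \<in> TM p \<Longrightarrow> u + v \<in> TM p"
  by (auto simp: tangent_space_def plus_fun_def algebra_simps)

lemma TM_scale: "v \<in> TM p \<Longrightarrow> scale_tv c v \<in> TM p"
  by (auto simp: tangent_space_def scale_tv_def algebra_simps)

lemma TM_zero: "0 \<in> TM p"
  by (auto simp: tangent_space_def zero_fun_def)

lemma scale_tv_zero: "scale_tv 0 v = 0"
  by (simp add: scale_tv_def fun_eq_iff)

lemma scale_tv_minus1: "scale_tv (-1) v = - v"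
  by (simp add: scale_tv_def fun_eq_iff)

lemma TM_uminus: "v \<in> TM p \<Longrightarrow> - v \<in> TM p"
  using TM_scale[of v p "-1"] by (simp add: scale_tv_minus1)

lemma TM_diff: "u \<in> TM p \<Longrightarrow> v \<in> TM p \<Longrightarrow> u - v \<in> TM p"
  using TM_add[OF _ TM_uminus] by fastforce

lemma TM_sum: "(\<And>i. i \<in> I \<Longrightarrow> b i \<in> TM p) \<Longrightarrow> (\<Sum>i\<in>I. b i) \<in> TM p"
  by (induction I rule: infinite_finite_induct) (auto intro: TM_add TM_zero)

lemma VF_TM: "VF X \<Longrightarrow> X p \<in> TM p"
  by (simp add: vector_field_def)

lemma deriv_smooth: "VF X \<Longrightarrow> f \<in> C \<Longrightarrow> (\<lambda>q. X q f) \<in> C"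
  by (simp add: vector_field_def deriv_along_def)

lemma VF_add: "VF X \<Longrightarrow> VF Y \<Longrightarrow> VF (X + Y)"
  by (auto simp: vector_field_def deriv_along_def TM_add smooth_add)

lemma VF_diff: "VF X \<Longrightarrow> VF Y \<Longrightarrow> VF (X - Y)"
  by (auto simp: vector_field_def deriv_along_def TM_diff smooth_diff)

lemma VF_uminus: "VF X \<Longrightarrow> VF (- X)"
  by (auto simp: vector_field_def deriv_along_def TM_uminus smooth_uminus)

lemma VF_D: "VF X \<Longrightarrow> VF Y \<Longrightarrow> VF (D X Y)"
  using lc by (simp add: levi_civita_def affine_connection_def)

lemma TM_apply_add: "v \<in> TM p \<Longrightarrow> f \<in> C \<Longrightarrow> h \<in> C \<Longrightarrow> v (\<lambda>q. f q + h q) = v f + v h"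
  and TM_apply_mult: "v \<in> TM p \<Longrightarrow> f \<in> C \<Longrightarrow> h \<in> C \<Longrightarrow> v (\<lambda>q. f q * h q) = f p * v h + h p * v f"
  and TM_apply_scale: "v \<in> TM p \<Longrightarrow> f \<in> C \<Longrightarrow> v (\<lambda>q. c * f q) = c * v f"
  and TM_apply_nonsmooth: "v \<in> TM p \<Longrightarrow> f \<notin> C \<Longrightarrow> v f = 0"
  by (auto simp: tangent_space_def)

lemma TM_apply_uminus: "v \<in> TM p \<Longrightarrow> f \<in> C \<Longrightarrow> v (\<lambda>q. - f q) = - v f"
  using TM_apply_scale[of v p f "-1"] by simp

lemma TM_apply_diff: "v \<in> TM p \<Longrightarrow> f \<in> C \<Longrightarrow> h \<in> C \<Longrightarrow> v (\<lambda>q. f q - h q) = v f - v h"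
  using TM_apply_add[of v p f "\<lambda>q. - h q"] TM_apply_uminus[of v p h] smooth_uminus[of h] by simp

lemma g_sym: "u \<in> TM p \<Longrightarrow> v \<in> TM p \<Longrightarrow> g p u v = g p v u"
  and g_scale: "u \<in> TM p \<Longrightarrow> v \<in> TM p \<Longrightarrow> g p (scale_tv c u) v = c * g p u v"
  and g_add: "u \<in> TM p \<Longrightarrow> v \<in> TM p \<Longrightarrow> w \<in> TM p \<Longrightarrow> g p (u + v) w = g p u w + g p v w"
  and g_pos: "v \<in> TM p \<Longrightarrow> v \<noteq> 0 \<Longrightarrow> g p v v > 0"
  and g_smooth: "VF X \<Longrightarrow> VF Y \<Longrightarrow> (\<lambda>p. g p (X p) (Y p)) \<in> C"
  using metric by (auto simp: riemannian_metric_def)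

lemma g_scale_right: "u \<in> TM p \<Longrightarrow> v \<in> TM p \<Longrightarrow> g p u (scale_tv c v) = c * g p u v"
  using g_scale[of v p u c] g_sym TM_scale by metis

lemma g_add_right:
  "u \<in> TM p \<Longrightarrow> v \<in> TM p \<Longrightarrow> w \<in> TM p \<Longrightarrow> g p u (v + w) = g p u v + g p u w"
  using g_add[of v p w u] g_sym TM_add by metis

lemma g_uminus: "u \<in> TM p \<Longrightarrow> v \<in> TM p \<Longrightarrow> g p (- u) v = - g p u v"
  using g_scale[of u p v "-1"] by (simp add: scale_tv_minus1)

lemma g_diff:
  "u \<in> TM p \<Longrightarrow> v \<in> TM p \<Longrightarrow> w \<in> TM p \<Longrightarrow> g p (u - v) w = g p u w - g p v w"
  using g_add[of u p "- v" w] g_uminus[of v p w] TM_uminus[of v p] by simp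

lemma g_diff_right:
  "u \<in> TM p \<Longrightarrow> v \<in> TM p \<Longrightarrow> w \<in> TM p \<Longrightarrow> g p u (v - w) = g p u v - g p u w"
  using g_diff[of v p w u] g_sym TM_diff by metis

lemma g_zero_right: "u \<in> TM p \<Longrightarrow> g p u 0 = 0"
  using g_diff_right[of u p u u] by simp

lemma g_sum_right:
  "u \<in> TM p \<Longrightarrow> (\<And>i. i \<in> I \<Longrightarrow> b i \<in> TM p) \<Longrightarrow>
    g p u (\<Sum>i\<in>I. scale_tv (c i) (b i)) = (\<Sum>i\<in>I. c i * g p u (b i))"
  by (induction I rule: infinite_finite_induct)
     (auto simp: g_add_right g_scale_right TM_scale TM_sum g_zero_right)

lemma D_add_left: "VF X \<Longrightarrow> VF X' \<Longrightarrow> VF Y \<Longrightarrow> D (X + X') Y = D X Y + D X' Y"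
  and D_add: "VF X \<Longrightarrow> VF Y \<Longrightarrow> VF Y' \<Longrightarrow> D X (Y + Y') = D X Y + D X Y'"
  and D_torsion_free: "VF X \<Longrightarrow> VF Y \<Longrightarrow> lie_bracket X Y = D X Y - D Y X"
  using lc by (simp_all add: levi_civita_def affine_connection_def)

lemma D_diff_left: "VF X \<Longrightarrow> VF X' \<Longrightarrow> VF Y \<Longrightarrow> D (X - X') Y = D X Y - D X' Y"
  using D_add_left[of "X - X'" X' Y] VF_diff[of X X'] by simp

lemma D_diff: "VF X \<Longrightarrow> VF Y \<Longrightarrow> VF Y' \<Longrightarrow> D X (Y - Y') = D X Y - D X Y'"
  using D_add[of X "Y - Y'" Y'] VF_diff[of Y Y'] by simp

lemma D_zero: "VF X \<Longrightarrow> D X 0 = 0"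
  using D_diff[of X X X] by simp

lemma D_metric:
  "VF X \<Longrightarrow> VF Y \<Longrightarrow> VF Z \<Longrightarrow>
    X p (\<lambda>p. g p (Y p) (Z p)) = g p (D X Y p) (Z p) + g p (Y p) (D X Z p)"
  using lc unfolding levi_civita_def deriv_along_def fun_eq_iff by blast

lemma VF_lie_bracket: "VF X \<Longrightarrow> VF Y \<Longrightarrow> VF (lie_bracket X Y)"
  by (simp add: D_torsion_free VF_diff VF_D)

lemma lie_bracket_eq: "lie_bracket X Y p f = X p (\<lambda>q. Y q f) - Y p (\<lambda>q. X q f)"
  by (simp add: lie_bracket_def deriv_along_def)

lemma jacobi_identity:
  assumes "VF X" "VF Y" "VF Z"
  shows "lie_bracket X (lie_bracket Y Z) + lie_bracket Y (lie_bracket Z X)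
    + lie_bracket Z (lie_bracket X Y) = 0"
proof (intro ext)
  fix p f
  show "(lie_bracket X (lie_bracket Y Z) + lie_bracket Y (lie_bracket Z X)
    + lie_bracket Z (lie_bracket X Y)) p f = 0 p f"
  proof (cases "f \<in> C")
    case True
    then show ?thesis
      by (simp add: lie_bracket_eq TM_apply_diff[OF VF_TM[OF assms(1)]]
          TM_apply_diff[OF VF_TM[OF assms(2)]] TM_apply_diff[OF VF_TM[OF assms(3)]]
          deriv_smooth[OF assms(1)] deriv_smooth[OF assms(2)] deriv_smooth[OF assms(3)])
  next
    case False
    \<comment> \<open>Tangent vectors are 0 on non-smooth functions by convention, so each double
      bracket vanishes there once it is known to be a vector field.\<close>
    have "VF (lie_bracket X (lie_bracket Y Z))" "VF (lie_bracket Y (lie_bracket Z X))"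
      "VF (lie_bracket Z (lie_bracket X Y))"
      using assms by (auto intro!: VF_lie_bracket)
    then show ?thesis using False by (simp add: TM_apply_nonsmooth[OF VF_TM])
  qed
qed

lemmas VF_closed = VF_add VF_diff VF_uminus VF_D VF_lie_bracket

section \<open>Symmetries of the curvature tensor\<close>

definition R where "R X Y Z W p = g p (curvature D X Y Z p) (W p)"

lemma VF_curvature: "VF X \<Longrightarrow> VF Y \<Longrightarrow> VF Z \<Longrightarrow> VF (curvature D X Y Z)"
  unfolding curvature_def by (intro VF_closed)

lemma R_eq:
  "VF X \<Longrightarrow> VF Y \<Longrightarrow> VF Z \<Longrightarrow> VF W \<Longrightarrow>
    R X Y Z W p = g p (D X (D Y Z) p) (W p) - g p (D Y (D X Z) p) (W p)
      - g p (D (lie_bracket X Y) Z p) (W p)"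
  unfolding R_def curvature_def by (simp add: g_diff VF_TM VF_closed TM_diff)

lemma R_skew_12:
  assumes "VF X" "VF Y" "VF Z" "VF W"
  shows "R Y X Z W p = - R X Y Z W p"
proof -
  have "D (lie_bracket Y X) Z = - D (lie_bracket X Y) Z"
    using assms by (simp add: D_torsion_free D_diff_left VF_closed)
  then have "curvature D Y X Z = - curvature D X Y Z"
    by (simp add: curvature_def)
  then show ?thesis using assms by (simp add: R_def g_uminus VF_TM VF_curvature)
qed

text \<open>Differentiate \<open>g(Z,W)\<close> along \<open>X\<close> and \<open>Y\<close> in both
  orders. The mixed terms cancel in the commutator, which is the derivative along the
  bracket.\<close>

lemma R_skew_34:
  assumes "VF X" "VF Y" "VF Z" "VF W"
  shows "R X Y W Z p = - R X Y Z W p"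
proof -
  let ?f = "\<lambda>q. g q (Z q) (W q)"
  have two: "U p (\<lambda>q. V q ?f) = g p (D U (D V Z) p) (W p) + g p (D V Z p) (D U W p)
      + g p (D U Z p) (D V W p) + g p (Z p) (D U (D V W) p)" if "VF U" "VF V" for U V
    using that assms
    by (simp add: D_metric TM_apply_add[OF VF_TM[OF that(1)]] g_smooth VF_D)
  have "lie_bracket X Y p ?f = g p (D (lie_bracket X Y) Z p) (W p) + g p (Z p) (D (lie_bracket X Y) W p)"
    using assms by (simp add: D_metric VF_closed)
  then have "R X Y Z W p + (g p (Z p) (D X (D Y W) p) - g p (Z p) (D Y (D X W) p)
      - g p (Z p) (D (lie_bracket X Y) W p)) = 0"
    using assms by (simp add: lie_bracket_eq two R_eq)
  moreover have "g p (Z p) V = g p V (Z p)" if "V \<in> TM p" for V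
    using that assms VF_TM g_sym by metis
  ultimately show ?thesis
    using assms by (simp add: R_eq VF_TM VF_closed)
qed

text \<open>Without torsion, brackets are differences of covariant derivatives, and the Jacobi
  identity turns into the cyclic sum.\<close>

lemma curvature_bianchi:
  assumes "VF X" "VF Y" "VF Z"
  shows "curvature D X Y Z + curvature D Y Z X + curvature D Z X Y = 0"
proof -
  have L: "lie_bracket U (lie_bracket V W) = D U (D V W) - D U (D W V) - D (lie_bracket V W) U"
    if "VF U" "VF V" "VF W" for U V W
  proof -
    have "lie_bracket U (lie_bracket V W) = D U (lie_bracket V W) - D (lie_bracket V W) U"
      using that by (simp add: D_torsion_free[of U] VF_closed)
    also have "D U (lie_bracket V W) = D U (D V W) - D U (D W V)"
      using that by (simp add: D_torsion_free D_diff VF_D)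
    finally show ?thesis .
  qed
  show ?thesis
    using jacobi_identity[OF assms] assms by (simp add: curvature_def L algebra_simps)
qed

lemma R_bianchi_123:
  assumes "VF X" "VF Y" "VF Z" "VF W"
  shows "R X Y Z W p + R Y Z X W p + R Z X Y W p = 0"
proof -
  have "R X Y Z W p + R Y Z X W p + R Z X Y W p
      = g p ((curvature D X Y Z + curvature D Y Z X + curvature D Z X Y) p) (W p)"
    using assms by (simp add: R_def g_add VF_TM VF_curvature TM_add)
  also have "\<dots> = 0"
    unfolding curvature_bianchi[OF assms(1-3)]
    using g_zero_right[OF VF_TM[OF assms(4)]] g_sym[OF TM_zero VF_TM[OF assms(4)]] by simp
  finally show ?thesis .
qed

text \<open>The octahedron argument: the Bianchi identities for the four cyclic shifts of the
  arguments, combined linearly with the two skew-symmetries.\<close>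

lemma R_pair:
  assumes "VF X" "VF Y" "VF Z" "VF W"
  shows "R X Y Z W p = R Z W X Y p"
  using R_bianchi_123[of X Y Z W p] R_bianchi_123[of Y Z W X p] R_bianchi_123[of Z W X Y p]
    R_bianchi_123[of W X Y Z p] R_skew_12[of X Y Z W p] R_skew_12[of Y Z X W p]
    R_skew_12[of X Z Y W p]  R_skew_12[of Y Z W X p] R_skew_12[of Z W Y X p]  R_skew_12[of W Y Z X p]
    R_skew_12[of Z W X Y p] R_skew_12[of W X Z Y p] R_skew_12[of X Z W Y p]
    R_skew_12[of W X Y Z p] R_skew_12[of X Y W Z p] R_skew_12[of Y W X Z p]
    R_skew_34[of X Y Z W p] R_skew_34[of Y Z X W p] R_skew_34[of X Z Y W p]
    R_skew_34[of Z W X Y p] R_skew_34[of Y W X Z p] R_skew_34[of W X Y Z p] R_skew_34[of W Y X Z p]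
    R_skew_34[of Z X Y W p]
    assms
  by simp

lemma R_bianchi_234:
  assumes "VF X" "VF Y" "VF Z" "VF W"
  shows "R X Y Z W p + R X Z W Y p + R X W Y Z p = 0"
  using R_bianchi_123[of Y Z W X p] R_pair[of X Y Z W p] R_pair[of X Z W Y p] R_pair[of X W Y Z p]
    R_skew_34[of Y Z X W p] R_skew_34[of Z W X Y p] R_skew_34[of W Y X Z p] assms
  by simp

text \<open>Skewness exchanges the third slot with the fourth, where additivity is that of
  \<open>g\<close>.\<close>

lemma R_add_3:
  assumes "VF X" "VF Y" "VF Z" "VF Z'" "VF W"
  shows "R X Y (Z + Z') W p = R X Y Z W p + R X Y Z' W p"
proof -
  have "R X Y W (Z + Z') p = R X Y W Z p + R X Y W Z' p"
    using assms by (simp add: R_def g_add_right VF_TM VF_curvature)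
  then show ?thesis
    using assms R_skew_34[of X Y W Z p] R_skew_34[of X Y W Z' p] R_skew_34[of X Y W "Z + Z'" p]
    by (simp add: VF_add)
qed

lemma R_uminus_3:
  assumes "VF X" "VF Y" "VF Z" "VF W"
  shows "R X Y (- Z) W p = - R X Y Z W p"
proof -
  have "VF (0 :: 'm vfield)" using VF_diff[OF assms(1,1)] by simp
  then have "R X Y 0 W p = 0" using R_add_3[of X Y 0 0 W p] assms by simp
  then show ?thesis using R_add_3[of X Y Z "- Z" W p] assms by (simp add: VF_uminus)
qed

text \<open>Pair symmetry and skewness carry the second slot into the third.\<close>

lemma R_add_2:
  assumes "VF X" "VF Y" "VF Y'" "VF Z" "VF W"
  shows "R X (Y + Y') Z W p = R X Y Z W p + R X Y' Z W p"
proof -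
  have "R X V Z W p = - R Z W V X p" if "VF V" for V
    using R_pair[of X V Z W p] R_skew_34[of Z W X V p] assms that by simp
  then show ?thesis using assms R_add_3[of Z W Y Y' X p] by (simp add: VF_add)
qed

end

section \<open>Nearly cosymplectic manifolds\<close>

locale nearly_cosymplectic = riemannian_manifold A g D
  for A :: "('m::{t2_space, second_countable_topology}, 'e::euclidean_space) atlas"
    and g :: "'m bilin" and D :: "'m connection" +
  fixes \<theta> :: "'m endo" and \<xi> :: "'m vfield" and \<eta> :: "'m oneform"
  assumes contact: "almost_contact_metric A \<theta> \<xi> \<eta> g"
    and nearly: "\<And>X Y. vector_field A X \<Longrightarrow> vector_field A Y \<Longrightarrow>
        cov_deriv_endo D \<theta> X Y + cov_deriv_endo D \<theta> Y X = 0"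
begin

abbreviation \<Theta> where "\<Theta> \<equiv> apply_endo \<theta>"

lemma VF_xi: "VF \<xi>"
  and g_xi_xi: "g p (\<xi> p) (\<xi> p) = 1"
  and eta_xi: "\<eta> p (\<xi> p) = 1"
  and theta_sq: "v \<in> TM p \<Longrightarrow> \<theta> p (\<theta> p v) = scale_tv (\<eta> p v) (\<xi> p) - v"
  and g_theta_theta_eta:
    "u \<in> TM p \<Longrightarrow> v \<in> TM p \<Longrightarrow> g p (\<theta> p u) (\<theta> p v) = g p u v - \<eta> p u * \<eta> p v"
  and theta_TM: "v \<in> TM p \<Longrightarrow> \<theta> p v \<in> TM p"
  and theta_add: "u \<in> TM p \<Longrightarrow> v \<in> TM p \<Longrightarrow> \<theta> p (u + v) = \<theta> p u + \<theta> p v"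
  and VF_Theta: "VF X \<Longrightarrow> VF (\<Theta> X)"
  using contact by (auto simp: almost_contact_metric_def endo_field_def)

lemmas VF_closed' = VF_closed VF_xi VF_Theta VF_curvature

lemma Theta_at: "\<Theta> X p = \<theta> p (X p)"
  by (simp add: apply_endo_def)

section \<open>Pointwise algebra of the almost contact metric structure\<close>

lemma theta_diff:
  assumes "u \<in> TM p" "v \<in> TM p"
  shows "\<theta> p (u - v) = \<theta> p u - \<theta> p v"
  using theta_add[of "u - v" p v] assms TM_diff by simp

lemma Theta_add: "VF X \<Longrightarrow> VF Y \<Longrightarrow> \<Theta> (X + Y) = \<Theta> X + \<Theta> Y"
  by (rule ext) (metis Theta_at plus_fun_apply theta_add VF_TM)

lemma theta_xi: "\<theta> p (\<xi> p) = 0"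
proof (rule ccontr)
  assume "\<theta> p (\<xi> p) \<noteq> 0"
  then have "g p (\<theta> p (\<xi> p)) (\<theta> p (\<xi> p)) > 0" by (simp add: g_pos theta_TM VF_TM VF_xi)
  then show False by (simp add: g_theta_theta_eta VF_TM VF_xi g_xi_xi eta_xi)
qed

lemma Theta_xi: "\<Theta> \<xi> = 0"
  by (rule ext) (simp add: Theta_at theta_xi)

lemma theta_scale_xi: "\<theta> p (scale_tv c (\<xi> p)) = 0"
  using contact theta_xi[of p] VF_TM[OF VF_xi, of p]
  by (auto simp: almost_contact_metric_def endo_field_def scale_tv_def fun_eq_iff)

lemma eta_eq:
  assumes "v \<in> TM p"
  shows "\<eta> p v = g p (\<xi> p) v"
proof -
  have "g p 0 (\<theta> p v) = 0"
    using g_zero_right[of "\<theta> p v" p] g_sym[OF TM_zero, of "\<theta> p v" p] theta_TM[OF assms] by simp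
  then show ?thesis
    using g_theta_theta_eta[OF VF_TM[OF VF_xi] assms] by (simp add: theta_xi eta_xi)
qed

lemma g_theta_theta:
  "u \<in> TM p \<Longrightarrow> v \<in> TM p \<Longrightarrow>
    g p (\<theta> p u) (\<theta> p v) = g p u v - g p (\<xi> p) u * g p (\<xi> p) v"
  by (simp add: g_theta_theta_eta eta_eq)

text \<open>Computing the cube of \<open>\<theta>\<close> as \<open>\<theta>\<close> after its
  square and as the square after \<open>\<theta>\<close> gives results differing by the
  \<open>\<xi>\<close>-component of \<open>\<theta> p v\<close>.\<close>

lemma g_xi_theta:
  assumes "v \<in> TM p"
  shows "g p (\<xi> p) (\<theta> p v) = 0"
proof -
  have "\<theta> p (\<theta> p (\<theta> p v)) = - \<theta> p v"
    using assms by (simp add: theta_sq[OF assms] theta_diff theta_scale_xi TM_scale VF_TM VF_xi)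
  moreover have "\<theta> p (\<theta> p (\<theta> p v)) = scale_tv (g p (\<xi> p) (\<theta> p v)) (\<xi> p) - \<theta> p v"
    by (simp add: theta_sq[OF theta_TM[OF assms]] eta_eq[OF theta_TM[OF assms]])
  ultimately have "scale_tv (g p (\<xi> p) (\<theta> p v)) (\<xi> p) = 0" by simp
  then show ?thesis
    using g_scale_right[OF VF_TM[OF VF_xi] VF_TM[OF VF_xi], of p "g p (\<xi> p) (\<theta> p v)"]
      g_zero_right[OF VF_TM[OF VF_xi], of p] by (simp add: g_xi_xi)
qed

lemma g_theta_skew:
  assumes "u \<in> TM p" "v \<in> TM p"
  shows "g p u (\<theta> p v) = - g p (\<theta> p u) v"
proof -
  have "g p (\<theta> p u) (\<theta> p (\<theta> p v)) = g p u (\<theta> p v)"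
    using assms by (simp add: g_theta_theta theta_TM g_xi_theta)
  moreover have "g p (\<theta> p u) (\<theta> p (\<theta> p v)) = - g p (\<theta> p u) v"
    using assms g_sym[of "\<theta> p u" p "\<xi> p"]
    by (simp add: theta_sq g_diff_right g_scale_right TM_scale VF_TM VF_xi theta_TM g_xi_theta)
  ultimately show ?thesis by simp
qed

section \<open>The 3-form \<open>psi\<close> and its covariant derivative\<close>

definition psi where "psi X Y Z p = g p (cov_deriv_endo D \<theta> X Y p) (Z p)"

lemma VF_cov: "VF X \<Longrightarrow> VF Y \<Longrightarrow> VF (cov_deriv_endo D \<theta> X Y)"
  unfolding cov_deriv_endo_def by (intro VF_closed')

lemma psi_eq:
  assumes "VF X" "VF Y" "VF Z"
  shows "psi X Y Z p = g p (D X (\<Theta> Y) p) (Z p) + g p (D X Y p) (\<theta> p (Z p))"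
  using assms
  by (simp add: psi_def cov_deriv_endo_def g_diff VF_TM VF_closed' Theta_at g_theta_skew theta_TM)

lemma psi_smooth: "VF X \<Longrightarrow> VF Y \<Longrightarrow> VF Z \<Longrightarrow> psi X Y Z \<in> C"
  using g_smooth[OF VF_cov] by (simp add: psi_def[abs_def])

lemma psi_skew_12:
  assumes "VF X" "VF Y" "VF Z"
  shows "psi Y X Z p = - psi X Y Z p"
proof -
  have "cov_deriv_endo D \<theta> Y X = - cov_deriv_endo D \<theta> X Y"
    using nearly[OF assms(2,1)] by (simp add: eq_neg_iff_add_eq_0)
  then show ?thesis using assms by (simp add: psi_def g_uminus VF_TM VF_cov)
qed

text \<open>Differentiate the skew-symmetry \<open>g(Y, \<theta>Z) = - g(\<theta>Y, Z)\<close> with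
  the metric connection. Together with \<open>psi_skew_12\<close> this makes \<open>psi\<close>
  totally skew.\<close>

lemma psi_skew_23:
  assumes "VF X" "VF Y" "VF Z"
  shows "psi X Z Y p = - psi X Y Z p"
proof -
  have "(\<lambda>q. g q (Y q) (\<Theta> Z q)) = (\<lambda>q. - g q (\<Theta> Y q) (Z q))"
    using assms by (simp add: Theta_at g_theta_skew VF_TM)
  then have "X p (\<lambda>q. g q (Y q) (\<Theta> Z q)) = - X p (\<lambda>q. g q (\<Theta> Y q) (Z q))"
    using TM_apply_uminus[OF VF_TM[OF assms(1)] g_smooth[of "\<Theta> Y" Z]] assms
    by (simp add: VF_Theta)
  then have "g p (D X Y p) (\<Theta> Z p) + g p (Y p) (D X (\<Theta> Z) p)
      + g p (D X (\<Theta> Y) p) (Z p) + g p (\<Theta> Y p) (D X Z p) = 0"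
    using assms by (simp add: D_metric VF_closed')
  then show ?thesis using assms
    g_sym[of "Y p" p "D X (\<Theta> Z) p"] g_sym[of "\<Theta> Y p" p "D X Z p"]
    by (simp add: psi_eq VF_closed' VF_TM theta_TM Theta_at)
qed

lemma psi_diff_1:
  assumes "VF U" "VF V" "VF Y" "VF Z"
  shows "psi (U - V) Y Z p = psi U Y Z p - psi V Y Z p"
  using assms by (simp add: psi_eq D_diff_left VF_closed' VF_TM g_diff theta_TM)

text \<open>The covariant derivative of the 3-form \<open>psi\<close> in direction \<open>X\<close>,
  evaluated on \<open>Y\<close>, \<open>Z\<close>, \<open>W\<close>.\<close>

definition T where
  "T X Y Z W p = X p (psi Y Z W) - psi (D X Y) Z W p - psi Y (D X Z) W p - psi Y Z (D X W) p"

lemma T_skew_23: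
  assumes "VF X" "VF Y" "VF Z" "VF W"
  shows "T X Z Y W p = - T X Y Z W p"
proof -
  have "psi Z Y W = (\<lambda>q. - psi Y Z W q)" using assms psi_skew_12 by blast
  then show ?thesis
    using assms psi_skew_12[of "D X Y" Z W p] psi_skew_12[of Y "D X Z" W p] psi_skew_12[of Y Z "D X W" p]
    by (simp add: T_def TM_apply_uminus[OF VF_TM[OF assms(1)]] psi_smooth VF_D)
qed

lemma T_skew_34:
  assumes "VF X" "VF Y" "VF Z" "VF W"
  shows "T X Y W Z p = - T X Y Z W p"
proof -
  have "psi Y W Z = (\<lambda>q. - psi Y Z W q)" using assms psi_skew_23 by blast
  then show ?thesis
    using assms psi_skew_23[of "D X Y" Z W p] psi_skew_23[of Y "D X Z" W p] psi_skew_23[of Y Z "D X W" p]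
    by (simp add: T_def TM_apply_uminus[OF VF_TM[OF assms(1)]] psi_smooth VF_D)
qed

text \<open>Arranged for antisymmetrising in \<open>X\<close> and \<open>Y\<close>: the two
  \<open>psi\<close> terms containing \<open>D Y Z\<close> and \<open>D X Z\<close> are jointly
  symmetric and cancel, and the last term leaves \<open>psi\<close> of the bracket.\<close>

lemma T_eq:
  assumes "VF X" "VF Y" "VF Z" "VF W"
  shows "T X Y Z W p = g p (D X (D Y (\<Theta> Z)) p) (W p) + g p (D X (D Y Z) p) (\<theta> p (W p))
    - psi X (D Y Z) W p - psi Y (D X Z) W p - psi (D X Y) Z W p"
proof -
  have "X p (psi Y Z W) = g p (D X (cov_deriv_endo D \<theta> Y Z) p) (W p) + psi Y Z (D X W) p"
    using assms by (simp add: psi_def[abs_def] D_metric VF_cov)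
  moreover have "g p (D X (cov_deriv_endo D \<theta> Y Z) p) (W p)
      = g p (D X (D Y (\<Theta> Z)) p) (W p) - g p (D X (\<Theta> (D Y Z)) p) (W p)"
    using assms by (simp add: cov_deriv_endo_def D_diff VF_closed' g_diff VF_TM)
  ultimately show ?thesis
    using assms psi_eq[of X "D Y Z" W p] by (simp add: T_def VF_closed')
qed

text \<open>The Ricci identity for \<open>\<theta>\<close>: by skewness of \<open>\<theta>\<close>,
  the right-hand side is the commutator of the curvature operator with \<open>\<theta>\<close>,
  applied to \<open>Z\<close> and paired with \<open>W\<close>.\<close>

lemma ricci_theta:
  assumes "VF X" "VF Y" "VF Z" "VF W"
  shows "T X Y Z W p - T Y X Z W p = R X Y (\<Theta> Z) W p + R X Y Z (\<Theta> W) p"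
  using assms psi_eq[of "lie_bracket X Y" Z W p]
  by (simp add: T_eq R_eq VF_closed' D_torsion_free Theta_at psi_diff_1)

section \<open>First and second covariant derivatives of \<open>\<xi>\<close>\<close>

definition kap where "kap X Y p = g p (D X \<xi> p) (Y p)"

lemma kap_smooth: "VF X \<Longrightarrow> VF Y \<Longrightarrow> kap X Y \<in> C"
  using g_smooth[OF VF_D[OF _ VF_xi]] by (simp add: kap_def[abs_def])

lemma kap_xi_right:
  assumes "VF X"
  shows "kap X \<xi> p = 0"
proof -
  \<comment> \<open>The constant 1 is smooth as the squared length of \<open>\<xi>\<close>; the
    Leibniz rule for 1 = 1 * 1 then makes its derivative zero.\<close>
  have one: "(\<lambda>q. 1) \<in> C" using g_smooth[OF VF_xi VF_xi] by (simp add: g_xi_xi)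
  have "X p (\<lambda>q. 1) = 0" using TM_apply_mult[OF VF_TM[OF assms] one one, of p] by simp
  then show ?thesis
    using D_metric[OF assms VF_xi VF_xi, of p] g_sym[of "\<xi> p" p "D X \<xi> p"]
    by (simp add: g_xi_xi kap_def VF_TM VF_closed' assms)
qed

text \<open>Since \<open>\<theta>\<close> kills \<open>\<xi>\<close>, the derivative of
  \<open>\<theta>\<close> applied to \<open>\<xi>\<close> only involves \<open>D X \<xi>\<close>;
  skewness then moves \<open>\<xi>\<close> to the first slot.\<close>

lemma psi_xi:
  assumes "VF X" "VF Y"
  shows "psi \<xi> X Y p = - kap X (\<Theta> Y) p"
proof -
  have "psi X \<xi> Y p = kap X (\<Theta> Y) p"
    using assms g_zero_right[OF VF_TM[OF assms(2)], of p] g_sym[OF TM_zero VF_TM[OF assms(2)], of p]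
    by (simp add: psi_eq VF_xi Theta_xi D_zero kap_def Theta_at)
  then show ?thesis using psi_skew_12[of X \<xi> Y p] assms VF_xi by simp
qed

text \<open>The derivative of the compatibility of \<open>\<theta>\<close> with the metric. For
  \<open>Y\<close> and \<open>Z\<close> orthogonal to \<open>\<xi>\<close> the right-hand side is
  zero, so \<open>\<theta>\<close> may be moved between the last two slots of
  \<open>psi\<close>.\<close>

lemma psi_Theta:
  assumes "VF X" "VF Y" "VF Z"
  shows "psi X (\<Theta> Y) Z p - psi X Y (\<Theta> Z) p
    = g p (\<xi> p) (Z p) * kap X Y p + g p (\<xi> p) (Y p) * kap X Z p"
proof -
  let ?e = "\<lambda>V q. g q (\<xi> q) (V q)"
  have e: "X p (?e V) = kap X V p + g p (\<xi> p) (D X V p)" if "VF V" for V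
    using that assms by (simp add: D_metric VF_xi kap_def)
  have eC: "?e V \<in> C" if "VF V" for V using that g_smooth VF_xi by blast
  have gTT: "(\<lambda>q. g q (\<Theta> Y q) (\<Theta> Z q)) = (\<lambda>q. g q (Y q) (Z q) - ?e Y q * ?e Z q)"
    using assms by (simp add: Theta_at g_theta_theta VF_TM)
  \<comment> \<open>The compatibility condition writes this product as a difference of two metric
    terms, which gives its smoothness.\<close>
  have "(\<lambda>q. ?e Y q * ?e Z q) = (\<lambda>q. g q (Y q) (Z q) - g q (\<Theta> Y q) (\<Theta> Z q))"
    using fun_cong[OF gTT] by (simp add: fun_eq_iff)
  then have prodC: "(\<lambda>q. ?e Y q * ?e Z q) \<in> C"
    using assms by (simp add: smooth_diff g_smooth VF_Theta)
  have "X p (\<lambda>q. g q (\<Theta> Y q) (\<Theta> Z q))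
      = X p (\<lambda>q. g q (Y q) (Z q)) - (?e Y p * X p (?e Z) + ?e Z p * X p (?e Y))"
    unfolding gTT
    using TM_apply_diff[OF VF_TM[OF assms(1)] g_smooth[OF assms(2,3)] prodC]
      TM_apply_mult[OF VF_TM[OF assms(1)] eC[OF assms(2)] eC[OF assms(3)]] by simp
  moreover have "X p (\<lambda>q. g q (\<Theta> Y q) (\<Theta> Z q))
      = g p (D X (\<Theta> Y) p) (\<theta> p (Z p)) + g p (\<theta> p (Y p)) (D X (\<Theta> Z) p)"
    using assms D_metric[of X "\<Theta> Y" "\<Theta> Z" p] by (simp add: VF_Theta) (simp add: Theta_at)
  ultimately have main: "g p (D X (\<Theta> Y) p) (\<theta> p (Z p)) + g p (\<theta> p (Y p)) (D X (\<Theta> Z) p)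
      = g p (D X Y p) (Z p) + g p (Y p) (D X Z p)
        - ?e Y p * (kap X Z p + g p (\<xi> p) (D X Z p)) - ?e Z p * (kap X Y p + g p (\<xi> p) (D X Y p))"
    using assms by (simp add: e D_metric)
  have "psi X (\<Theta> Y) Z p = - psi X Z (\<Theta> Y) p"
    using assms by (intro psi_skew_23) (auto intro: VF_closed')
  also have "\<dots> = - g p (D X (\<Theta> Z) p) (\<theta> p (Y p)) - g p (D X Z p) (\<theta> p (\<theta> p (Y p)))"
    using assms by (simp add: psi_eq VF_closed' Theta_at)
  also have "g p (D X Z p) (\<theta> p (\<theta> p (Y p))) = - g p (Y p) (D X Z p) + ?e Y p * g p (\<xi> p) (D X Z p)"
    using assms g_sym[of "D X Z p" p "\<theta> p (\<theta> p (Y p))"]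
    by (simp add: theta_sq eta_eq VF_TM VF_closed' g_diff g_scale TM_scale TM_diff)
  finally have 1: "psi X (\<Theta> Y) Z p = - g p (\<theta> p (Y p)) (D X (\<Theta> Z) p)
      + g p (Y p) (D X Z p) - ?e Y p * g p (\<xi> p) (D X Z p)"
    using assms g_sym[of "D X (\<Theta> Z) p" p "\<theta> p (Y p)"] by (simp add: VF_TM VF_closed' theta_TM)
  have 2: "psi X Y (\<Theta> Z) p = g p (D X (\<Theta> Y) p) (\<theta> p (Z p))
      - g p (D X Y p) (Z p) + ?e Z p * g p (\<xi> p) (D X Y p)"
    using assms g_sym[of "D X Y p" p "\<xi> p"]
    by (simp add: psi_eq VF_closed' Theta_at theta_sq eta_eq VF_TM g_diff_right g_scale_right
        TM_scale)
  show ?thesis using main 1 2 by (simp add: algebra_simps)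
qed

text \<open>\<open>D X \<xi>\<close> is orthogonal to \<open>\<xi>\<close> because
  \<open>\<xi>\<close> has constant length, so the \<open>\<xi>\<close>-component of the square of
  \<open>\<theta>\<close> does not contribute.\<close>

lemma kap_theta_theta:
  assumes "VF X" "VF Y"
  shows "kap X (\<Theta> (\<Theta> Y)) p = - kap X Y p"
proof -
  have "g p (D X \<xi> p) (\<xi> p) = 0" using kap_xi_right[OF assms(1)] by (simp add: kap_def)
  then show ?thesis
    using assms
    by (simp add: kap_def Theta_at theta_sq VF_TM VF_closed' g_diff_right g_scale_right
        TM_scale)
qed

text \<open>The integral curves of \<open>\<xi>\<close> are geodesics: \<open>psi\<close> vanishes
  on a repeated \<open>\<xi>\<close>, and \<open>psi_xi\<close> expresses that value through
  \<open>kap \<xi>\<close>.\<close>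

lemma kap_xi_left:
  assumes "VF X"
  shows "kap \<xi> X p = 0"
proof -
  have "psi \<xi> \<xi> (\<Theta> X) p = 0"
    using psi_skew_12[of \<xi> \<xi> "\<Theta> X" p] assms by (simp add: VF_closed')
  then show ?thesis
    using assms kap_theta_theta[of \<xi> X p] psi_xi[of \<xi> "\<Theta> X" p] by (simp add: VF_closed')
qed

text \<open>\<open>\<xi>\<close> is a Killing field.\<close>

lemma kap_skew:
  assumes "VF X" "VF Y"
  shows "kap Y X p = - kap X Y p"
proof -
  \<comment> \<open>The right-hand side of \<open>psi_Theta\<close> vanishes in direction
    \<open>\<xi>\<close> by \<open>kap_xi_left\<close>. Evaluating both sides with
    \<open>psi_xi\<close> gives the claim.\<close>
  have "psi \<xi> (\<Theta> X) Y p = psi \<xi> X (\<Theta> Y) p"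
    using psi_Theta[of \<xi> X Y p] assms by (simp add: kap_xi_left VF_xi)
  moreover have "psi \<xi> X (\<Theta> Y) p = kap X Y p"
    using assms by (simp add: psi_xi VF_closed' kap_theta_theta)
  moreover have "psi \<xi> (\<Theta> X) Y p = - kap Y X p"
    using assms psi_skew_23[of \<xi> Y "\<Theta> X" p] psi_xi[of Y "\<Theta> X" p]
    by (simp add: VF_closed' kap_theta_theta)
  ultimately show ?thesis by simp
qed

text \<open>The covariant derivative of the 2-form \<open>kap\<close>, that is, the second covariant
  derivative of \<open>\<xi>\<close> paired with \<open>Z\<close>.\<close>

definition B where
  "B X Y Z p = X p (kap Y Z) - kap (D X Y) Z p - kap Y (D X Z) p"

lemma B_skew:
  assumes "VF X" "VF Y" "VF Z"
  shows "B X Z Y p = - B X Y Z p"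
proof -
  have "kap Z Y = (\<lambda>q. - kap Y Z q)" using assms kap_skew by blast
  then show ?thesis
    using assms kap_skew[of "D X Y" Z p] kap_skew[of Y "D X Z" p]
    by (simp add: B_def TM_apply_uminus[OF VF_TM[OF assms(1)]] kap_smooth VF_D)
qed

lemma ricci_xi:
  assumes "VF X" "VF Y" "VF Z"
  shows "B X Y Z p - B Y X Z p = R X Y \<xi> Z p"
proof -
  have B: "B U V Z p = g p (D U (D V \<xi>) p) (Z p) - kap (D U V) Z p" if "VF U" "VF V" for U V
    using that assms by (simp add: B_def kap_def[abs_def] D_metric VF_closed')
  show ?thesis
    using assms by (simp add: B R_eq VF_closed' D_torsion_free kap_def D_diff_left g_diff VF_TM)
qed

text \<open>Kostant's identity for Killing fields. As for the Koszul formula, three cyclic Ricci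
  identities and skewness of \<open>B\<close> in its last two arguments determine \<open>B\<close>;
  pair symmetry and Bianchi reduce the result to one curvature term.\<close>

lemma B_eq:
  assumes "VF X" "VF Y" "VF Z"
  shows "B X Y Z p = - R \<xi> X Y Z p"
proof -
  have "R U V \<xi> W p = R \<xi> W U V p" if "VF U" "VF V" "VF W" for U V W
    using that VF_xi by (intro R_pair)
  then show ?thesis
    using assms VF_xi R_bianchi_234[of \<xi> X Y Z p]
      ricci_xi[of X Y Z p] ricci_xi[of Y Z X p] ricci_xi[of Z X Y p]
      B_skew[of X Y Z p] B_skew[of Y Z X p] B_skew[of Z X Y p]
    by simp
qed

text \<open>Differentiate \<open>\<nabla>\<^sub>\<xi> \<theta> = \<theta> \<circ> \<nabla>\<xi>\<close>.\<close>

lemma T_xi: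
  assumes "VF X" "VF Z" "VF W"
  shows "T X \<xi> Z W p = R \<xi> X Z (\<Theta> W) p - psi X W (D Z \<xi>) p - psi (D X \<xi>) Z W p"
proof -
  have "psi \<xi> Z W = (\<lambda>q. - kap Z (\<Theta> W) q)" using assms psi_xi by blast
  then have "X p (psi \<xi> Z W) = - X p (kap Z (\<Theta> W))"
    using assms by (simp add: TM_apply_uminus[OF VF_TM[OF assms(1)]] kap_smooth VF_closed')
  moreover have "B X Z (\<Theta> W) p = X p (kap Z (\<Theta> W)) - kap (D X Z) (\<Theta> W) p - kap Z (D X (\<Theta> W)) p"
    by (simp add: B_def)
  \<comment> \<open>The left side is \<open>D Z \<xi>\<close> paired with the derivative of
    \<open>\<theta>\<close> along \<open>X\<close>, applied to \<open>W\<close>.\<close>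
  moreover have "kap Z (D X (\<Theta> W)) p - kap Z (\<Theta> (D X W)) p = psi X W (D Z \<xi>) p"
    using assms g_sym[of "D Z \<xi> p" p "cov_deriv_endo D \<theta> X W p"]
    by (simp add: kap_def psi_def VF_TM VF_cov VF_closed')
       (simp add: cov_deriv_endo_def g_diff_right VF_TM VF_closed')
  ultimately show ?thesis
    using assms by (simp add: T_def B_eq VF_closed' psi_xi)
qed

text \<open>A linear system. With a the claimed zero, b = \<open>R \<xi> Z Z (\<Theta> X) p\<close>,
  d = \<open>R \<xi> (\<Theta> Z) Z X p\<close> and s = \<open>psi Z ?h X p\<close>, the facts are a
  + 2b + 2s = 0, a + b + d = 0 and, by \<open>c\<close> and Bianchi, a - d + s = 0. They force a =
  0.\<close>

lemma R_xi_theta_zero: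
  assumes "VF Z" "VF X"
  shows "R \<xi> Z (\<Theta> Z) X p = 0"
proof -
  let ?h = "D Z \<xi>"
  note VF = assms VF_xi VF_Theta[OF assms(1)] VF_Theta[OF assms(2)] VF_D[OF assms(1) VF_xi]
  have c: "R \<xi> X Z (\<Theta> Z) p = psi Z ?h X p"
    using T_xi[of X Z Z p] T_skew_34[of X \<xi> Z Z p] psi_skew_23[of "D X \<xi>" Z Z p]
      psi_skew_12[of X Z ?h p] psi_skew_23[of Z X ?h p] VF VF_D[OF assms(2) VF_xi]
    by simp
  have n1: "R \<xi> Z (\<Theta> Z) X p + 2 * R \<xi> Z Z (\<Theta> X) p + 2 * psi Z ?h X p = 0"
    using ricci_theta[of \<xi> Z Z X p] T_skew_23[of \<xi> Z Z X p] T_xi[of Z Z X p]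
      psi_skew_23[of Z ?h X p] psi_skew_12[of ?h Z X p] VF by simp
  \<comment> \<open>\<open>T Z \<xi> Z X p\<close> is evaluated by two Ricci identities, the second
    with \<open>\<xi>\<close> in the last slot, where \<open>\<theta>\<close> kills it.\<close>
  have n2: "R \<xi> Z (\<Theta> Z) X p + R \<xi> Z Z (\<Theta> X) p + R \<xi> (\<Theta> Z) Z X p = 0"
  proof -
    have "R X Z (\<Theta> Z) \<xi> p = R \<xi> (\<Theta> Z) Z X p"
      using VF R_pair[of X Z "\<Theta> Z" \<xi> p] R_skew_12[of "\<Theta> Z" \<xi> X Z p]
        R_skew_34[of \<xi> "\<Theta> Z" Z X p] by simp
    moreover have "R X Z Z 0 p = 0"
      using VF by (simp add: R_def g_zero_right VF_TM VF_curvature)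
    ultimately show ?thesis
      using VF ricci_theta[of \<xi> Z Z X p] ricci_theta[of X Z Z \<xi> p]
        T_skew_23[of \<xi> Z Z X p] T_skew_23[of X Z Z \<xi> p]
        T_skew_34[of Z \<xi> Z X p] T_skew_23[of Z \<xi> X Z p]  T_skew_34[of Z X \<xi> Z p]
      by (simp add: Theta_xi)
  qed
  have "R \<xi> Z (\<Theta> Z) X p + R \<xi> (\<Theta> Z) X Z p + R \<xi> X Z (\<Theta> Z) p = 0"
    using R_bianchi_234[of \<xi> Z "\<Theta> Z" X p] VF by simp
  then show ?thesis using c n1 n2 R_skew_34[of \<xi> "\<Theta> Z" Z X p] VF by simp
qed

text \<open>Polarisation of \<open>R_xi_theta_zero\<close>.\<close>

lemma R_xi_theta_skew:
  assumes "VF Y" "VF Z" "VF X"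
  shows "R \<xi> Y (\<Theta> Z) X p = - R \<xi> Z (\<Theta> Y) X p"
  using R_xi_theta_zero[of "Y + Z" X p] R_xi_theta_zero[of Y X p] R_xi_theta_zero[of Z X p] assms
  by (simp add: VF_closed' Theta_add R_add_3 R_add_2)

section \<open>Curvature and the derivative of \<open>J\<close> on the distribution\<close>

abbreviation orth where "orth \<equiv> orth_section A g \<xi>"

lemma orth_VF: "orth Y \<Longrightarrow> VF Y"
  and orth_g: "orth Y \<Longrightarrow> g p (\<xi> p) (Y p) = 0"
  by (auto simp: orth_section_def orth_distribution_def)

lemma orth_Theta: "VF Y \<Longrightarrow> orth (\<Theta> Y)"
  by (auto simp: orth_section_def orth_distribution_def Theta_at g_xi_theta VF_TM theta_TM VF_Theta)

lemma Theta_Theta: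
  assumes "orth Y"
  shows "\<Theta> (\<Theta> Y) = - Y"
proof
  fix p
  show "\<Theta> (\<Theta> Y) p = (- Y) p"
    using assms
    by (simp add: Theta_at theta_sq eta_eq orth_g VF_TM orth_VF scale_tv_zero)
qed

lemma R_xi_orth:
  assumes "orth X" "orth Y" "orth Z"
  shows "R \<xi> X Y Z p = 0"
proof -
  \<comment> \<open>Polarised skewness together with \<open>\<theta>\<close> squaring to -1 removes
    both \<open>\<theta>\<close> from the other two terms of the Bianchi identity for
    \<open>U\<close>, \<open>\<Theta> V\<close>, \<open>\<Theta> W\<close>.\<close>
  have F: "R \<xi> U (\<Theta> V) (\<Theta> W) p = - R \<xi> U V W p" if "orth U" "orth V" "orth W" for U V W
  proof -
    note VF = that[THEN orth_VF] that[THEN orth_VF, THEN VF_Theta] VF_xi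
    have "R \<xi> (\<Theta> V') (\<Theta> U') W' p = R \<xi> U' V' W' p"
      if "VF U'" "orth V'" "VF W'" for U' V' W'
      using that R_xi_theta_skew[of U' "\<Theta> V'" W' p]
      by (simp add: Theta_Theta R_uminus_3 orth_VF VF_closed')
    from this[of W V U] this[of V W U] show ?thesis
      using that VF R_bianchi_234[of \<xi> U "\<Theta> V" "\<Theta> W" p] R_bianchi_234[of \<xi> U V W p]
        R_skew_34[of \<xi> "\<Theta> W" "\<Theta> V" U p] R_skew_34[of \<xi> W U V p]
      by simp
  qed
  \<comment> \<open>Hence the curvature is totally skew in its last three slots, and Bianchi says
    that three times it is zero.\<close>
  have "R \<xi> V U W p = - R \<xi> U V W p" if "orth U" "orth V" "orth W" for U V W
    using F[of U V W] F[of V U W] R_xi_theta_skew[of U V "\<Theta> W" p] that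
    by (simp add: orth_VF VF_Theta)
  from this[of X Y Z] this[of X Z Y] show ?thesis
    using assms R_bianchi_234[of \<xi> X Y Z p] R_skew_34[of \<xi> X Y Z p] R_skew_34[of \<xi> Y X Z p]
    by (simp add: orth_VF VF_xi)
qed

text \<open>The derivative of \<open>J\<close> is the projection of that of \<open>\<theta>\<close>:
  \<open>\<theta>\<close> kills the \<open>\<xi>\<close>-component removed by the projection and has
  image orthogonal to \<open>\<xi>\<close>.\<close>

lemma proj_cov_deriv_restr:
  assumes "VF X" "orth Y"
  shows "cov_deriv_endo (proj_connection g \<xi> D) (restr_endo A g \<xi> \<theta>) X Y p
    = cov_deriv_endo D \<theta> X Y p - scale_tv (g p (\<xi> p) (cov_deriv_endo D \<theta> X Y p)) (\<xi> p)"
proof -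
  let ?J = "restr_endo A g \<xi> \<theta>" and ?P = "proj_connection g \<xi> D"
  have Y: "VF Y" using assms by (simp add: orth_VF)
  have J: "apply_endo ?J Y = \<Theta> Y"
    using assms by (auto simp: apply_endo_def restr_endo_def orth_section_def fun_eq_iff)
  \<comment> \<open>\<open>restr_endo\<close> can be evaluated only on the distribution.\<close>
  have "?P X Y p \<in> orth_distribution A g \<xi> p"
    using assms Y by (simp add: proj_connection_def orth_distribution_def TM_diff TM_scale VF_TM VF_closed'
        g_diff_right g_scale_right g_xi_xi)
  then have "apply_endo ?J (?P X Y) p = \<theta> p (?P X Y p)"
    by (simp add: apply_endo_def restr_endo_def)
  also have "\<dots> = \<theta> p (D X Y p)"
    using assms Y by (simp add: proj_connection_def theta_diff theta_scale_xi TM_scale VF_TM VF_closed')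
  finally have JD: "apply_endo ?J (?P X Y) p = \<theta> p (D X Y p)" .
  have "g p (\<xi> p) (cov_deriv_endo D \<theta> X Y p) = g p (\<xi> p) (D X (\<Theta> Y) p)"
    using assms Y by (simp add: cov_deriv_endo_def Theta_at g_diff_right g_xi_theta VF_TM VF_closed' theta_TM)
  then show ?thesis
    by (simp add: cov_deriv_endo_def[of ?P] J JD)
       (simp add: proj_connection_def cov_deriv_endo_def Theta_at)
qed

lemma orthonormal_expansion:
  assumes "orthonormal_basis_at A g \<xi> p m b" "v \<in> orth_distribution A g \<xi> p"
  shows "v = (\<Sum>k=1..m. scale_tv (g p v (b k)) (b k))"
proof -
  obtain c where c: "v = (\<Sum>k=1..m. scale_tv (c k) (b k))"
    using assms unfolding orthonormal_basis_at_def by blast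
  have b: "b k \<in> TM p" if "k \<in> {1..m}" for k
    using assms that by (auto simp: orthonormal_basis_at_def orth_distribution_def)
  have "g p v (b k) = c k" if k: "k \<in> {1..m}" for k
  proof -
    have "g p v (b k) = g p (b k) v"
      using assms(2) b[OF k] by (intro g_sym) (auto simp: orth_distribution_def)
    also have "\<dots> = (\<Sum>l=1..m. c l * g p (b k) (b l))"
      unfolding c by (rule g_sum_right) (use b k in auto)
    also have "\<dots> = (\<Sum>l=1..m. if k = l then c l else 0)"
      using assms(1) k by (intro sum.cong) (auto simp: orthonormal_basis_at_def)
    also have "\<dots> = c k" using k by simp
    finally show ?thesis .
  qed
  then show ?thesis using c by simp
qed

section \<open>Traces over a frame that is orthonormal at \<open>p\<close>\<close>

context
  fixes p :: 'm and m :: nat and F :: "nat \<Rightarrow> 'm vfield"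
  assumes F: "\<And>j. j \<in> {1..m} \<Longrightarrow> orth (F j)"
    and basis: "orthonormal_basis_at A g \<xi> p m (\<lambda>j. F j p)"
begin

lemma VF_F: "j \<in> {1..m} \<Longrightarrow> VF (F j)"
  using F orth_VF by blast

text \<open>The expansion in the frame is valid only at \<open>p\<close>, so it is stated inside the
  pointwise metric and not for the sections.\<close>

lemma g_Theta_frame:
  assumes "j \<in> {1..m}" "w \<in> TM p"
  shows "g p w (\<Theta> (F j) p) = (\<Sum>l=1..m. g p (\<Theta> (F j) p) (F l p) * g p w (F l p))"
proof -
  have "\<Theta> (F j) p \<in> orth_distribution A g \<xi> p"
    using orth_Theta[OF VF_F[OF assms(1)]] by (simp add: orth_section_def)
  from orthonormal_expansion[OF basis this]
  have "g p w (\<Theta> (F j) p)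
      = g p w (\<Sum>l=1..m. scale_tv (g p (\<Theta> (F j) p) (F l p)) (F l p))" by simp
  also have "\<dots> = (\<Sum>l=1..m. g p (\<Theta> (F j) p) (F l p) * g p w (F l p))"
    using assms by (intro g_sum_right) (simp_all add: VF_TM VF_F)
  finally show ?thesis .
qed

text \<open>Parseval: the first vector lies in the distribution, so expanding it in the frame
  suffices although the second may have a \<open>\<xi>\<close>-component.\<close>

lemma g_proj_cov_deriv:
  assumes "VF X" "VF Y" "j \<in> {1..m}"
  shows "g p (cov_deriv_endo (proj_connection g \<xi> D) (restr_endo A g \<xi> \<theta>) X (F j) p)
      (curvature_commutator D \<theta> X Y (F j) p)
    = (\<Sum>k=1..m. psi X (F j) (F k) p
        * (R X Y (\<Theta> (F j)) (F k) p + R X Y (F j) (\<Theta> (F k)) p))"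
proof -
  let ?v = "cov_deriv_endo (proj_connection g \<xi> D) (restr_endo A g \<xi> \<theta>) X (F j) p"
  let ?w = "curvature_commutator D \<theta> X Y (F j) p"
  note VF_j = VF_F[OF assms(3)]
  have cov: "VF (cov_deriv_endo D \<theta> X (F j))" using assms VF_j by (intro VF_cov)
  note v = proj_cov_deriv_restr[OF assms(1) F[OF assms(3)], of p]
  have v_orth: "?v \<in> orth_distribution A g \<xi> p"
    unfolding v orth_distribution_def using VF_TM[OF cov, of p] VF_TM[OF VF_xi, of p]
    by (simp add: TM_diff TM_scale g_diff_right g_scale_right g_xi_xi)
  have gv: "g p ?v (F k p) = psi X (F j) (F k) p" if "k \<in> {1..m}" for k
    unfolding v using VF_TM[OF cov, of p] VF_TM[OF VF_xi, of p] VF_TM[OF VF_F[OF that], of p]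
      orth_g[OF F[OF that], of p]
    by (simp add: g_diff g_scale TM_scale psi_def)
  have w: "?w \<in> TM p"
    using assms VF_j by (simp add: curvature_commutator_def TM_diff VF_TM VF_closed')
  have gw: "g p ?w (F k p) = R X Y (\<Theta> (F j)) (F k) p + R X Y (F j) (\<Theta> (F k)) p"
    if "k \<in> {1..m}" for k
    using assms VF_j VF_F[OF that]
    by (simp add: curvature_commutator_def R_def g_diff VF_TM VF_closed' Theta_at g_theta_skew theta_TM)
  have "g p ?v ?w = g p ?w ?v"
    using v_orth w by (intro g_sym) (auto simp: orth_distribution_def)
  also have "\<dots> = g p ?w (\<Sum>k=1..m. scale_tv (g p ?v (F k p)) (F k p))"
    using orthonormal_expansion[OF basis v_orth] by simp
  also have "\<dots> = (\<Sum>k=1..m. g p ?v (F k p) * g p ?w (F k p))"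
    using w by (intro g_sum_right) (simp_all add: VF_TM VF_F)
  also have "\<dots> = (\<Sum>k=1..m. psi X (F j) (F k) p
        * (R X Y (\<Theta> (F j)) (F k) p + R X Y (F j) (\<Theta> (F k)) p))"
    by (intro sum.cong) (simp_all only: gv gw)
  finally show ?thesis .
qed

lemma sum_psi_R_Theta:
  assumes X: "VF X"
  shows "(\<Sum>i=1..m. \<Sum>j=1..m. \<Sum>k=1..m. psi (F i) (F j) (F k) p * R (F i) X (\<Theta> (F j)) (F k) p) = 0"
proof -
  let ?I = "{1..m}"
  let ?a = "\<lambda>j l. g p (\<Theta> (F j) p) (F l p)"
  let ?r = "\<lambda>i l k. R (F i) X (F l) (F k) p"
  let ?\<Phi> = "\<lambda>i l k. psi (F i) (\<Theta> (F l)) (F k) p"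
  have a: "?a l j = - ?a j l" if "j \<in> ?I" "l \<in> ?I" for j l
    using that VF_F[of j] VF_F[of l] g_theta_skew[of "F j p" p "F l p"]
      g_sym[of "F j p" p "\<theta> p (F l p)"]
    by (simp add: Theta_at VF_TM theta_TM)
  have \<Phi>: "?\<Phi> i l k = (\<Sum>j\<in>?I. ?a l j * psi (F i) (F j) (F k) p)"
    if "i \<in> ?I" "l \<in> ?I" "k \<in> ?I" for i l k
  proof -
    \<comment> \<open>The last slot of \<open>psi\<close> is pointwise by definition, so
      \<open>\<Theta> (F l)\<close> is moved there before it is expanded.\<close>
    have "?\<Phi> i l k = - psi (F i) (F k) (\<Theta> (F l)) p"
      using that VF_F by (intro psi_skew_23) (auto intro: VF_Theta)
    also have "\<dots> = - (\<Sum>j\<in>?I. ?a l j * psi (F i) (F k) (F j) p)"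
      using that g_Theta_frame[of l "cov_deriv_endo D \<theta> (F i) (F k) p"]
      by (simp add: psi_def VF_TM VF_cov VF_F)
    also have "\<dots> = (\<Sum>j\<in>?I. ?a l j * psi (F i) (F j) (F k) p)"
      unfolding sum_negf[symmetric]
    proof (rule sum.cong[OF refl])
      fix j assume "j \<in> ?I"
      then show "- (?a l j * psi (F i) (F k) (F j) p) = ?a l j * psi (F i) (F j) (F k) p"
        using that psi_skew_23[of "F i" "F j" "F k" p] VF_F by simp
    qed
    finally show ?thesis .
  qed
  have R\<Theta>: "R (F i) X (\<Theta> (F j)) (F k) p = (\<Sum>l\<in>?I. ?a j l * ?r i l k)"
    if "i \<in> ?I" "j \<in> ?I" "k \<in> ?I" for i j k
  proof -
    have "R (F i) X (\<Theta> (F j)) (F k) p = - R (F i) X (F k) (\<Theta> (F j)) p"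
      using that X VF_F by (intro R_skew_34) (auto intro: VF_Theta)
    also have "\<dots> = - (\<Sum>l\<in>?I. ?a j l * ?r i k l)"
      using that X g_Theta_frame[of j "curvature D (F i) X (F k) p"]
      by (simp add: R_def VF_TM VF_curvature VF_F)
    also have "\<dots> = (\<Sum>l\<in>?I. ?a j l * ?r i l k)"
      unfolding sum_negf[symmetric]
    proof (rule sum.cong[OF refl])
      fix l assume "l \<in> ?I"
      then show "- (?a j l * ?r i k l) = ?a j l * ?r i l k"
        using that X R_skew_34[of "F i" X "F l" "F k" p] VF_F by simp
    qed
    finally show ?thesis .
  qed
  \<comment> \<open>\<open>psi_Theta\<close> moves \<open>\<theta>\<close> from \<open>F l\<close>
    to \<open>F k\<close>; two transpositions then produce the cyclic shift.\<close>
  have cyc: "?\<Phi> i l k = ?\<Phi> l k i" if "i \<in> ?I" "l \<in> ?I" "k \<in> ?I" for i l k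
    using that VF_F[of i] VF_F[of l] VF_F[of k] VF_Theta[of "F k"]
      psi_Theta[of "F i" "F l" "F k" p] orth_g[OF F[of l], of p] orth_g[OF F[of k], of p]
      psi_skew_12[of "F i" "F l" "\<Theta> (F k)" p] psi_skew_23[of "F l" "F i" "\<Theta> (F k)" p]
    by simp
  have rot: "(\<Sum>i\<in>?I. \<Sum>j\<in>?I. \<Sum>k\<in>?I. f j k i) = (\<Sum>i\<in>?I. \<Sum>j\<in>?I. \<Sum>k\<in>?I. f i j k)"
    for f :: "nat \<Rightarrow> nat \<Rightarrow> nat \<Rightarrow> real"
  proof -
    have "(\<Sum>i\<in>?I. \<Sum>j\<in>?I. \<Sum>k\<in>?I. f j k i) = (\<Sum>j\<in>?I. \<Sum>i\<in>?I. \<Sum>k\<in>?I. f j k i)"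
      by (rule sum.swap)
    also have "\<dots> = (\<Sum>j\<in>?I. \<Sum>k\<in>?I. \<Sum>i\<in>?I. f j k i)"
      by (intro sum.cong refl sum.swap)
    finally show ?thesis .
  qed
  let ?S = "\<Sum>i\<in>?I. \<Sum>l\<in>?I. \<Sum>k\<in>?I. ?\<Phi> i l k * ?r i l k"
  have S1: "?S = (\<Sum>i\<in>?I. \<Sum>l\<in>?I. \<Sum>k\<in>?I. ?\<Phi> i l k * ?r l k i)"
  proof -
    have "?S = (\<Sum>i\<in>?I. \<Sum>l\<in>?I. \<Sum>k\<in>?I. ?\<Phi> l k i * ?r l k i)"
      by (rule rot[symmetric])
    also have "\<dots> = (\<Sum>i\<in>?I. \<Sum>l\<in>?I. \<Sum>k\<in>?I. ?\<Phi> i l k * ?r l k i)"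
      by (intro sum.cong refl arg_cong2[where f="(*)"] cyc[symmetric])
    finally show ?thesis .
  qed
  have S2: "?S = (\<Sum>i\<in>?I. \<Sum>l\<in>?I. \<Sum>k\<in>?I. ?\<Phi> i l k * ?r k i l)"
  proof -
    have "?S = (\<Sum>i\<in>?I. \<Sum>l\<in>?I. \<Sum>k\<in>?I. ?\<Phi> l k i * ?r i l k)"
      by (intro sum.cong refl arg_cong2[where f="(*)"] cyc)
    also have "\<dots> = (\<Sum>i\<in>?I. \<Sum>l\<in>?I. \<Sum>k\<in>?I. ?\<Phi> i l k * ?r k i l)"
      by (rule rot[of "\<lambda>i l k. ?\<Phi> i l k * ?r k i l"])
    finally show ?thesis .
  qed
  let ?b = "\<lambda>i l k. ?\<Phi> i l k * (?r i l k + ?r l k i + ?r k i l)"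
  \<comment> \<open>Averaging over the three cyclic relabellings puts the Bianchi sum next to the
    invariant factor.\<close>
  have "(\<Sum>i\<in>?I. \<Sum>l\<in>?I. \<Sum>k\<in>?I. ?b i l k) = ?S
      + (\<Sum>i\<in>?I. \<Sum>l\<in>?I. \<Sum>k\<in>?I. ?\<Phi> i l k * ?r l k i)
      + (\<Sum>i\<in>?I. \<Sum>l\<in>?I. \<Sum>k\<in>?I. ?\<Phi> i l k * ?r k i l)"
    by (simp only: sum.distrib distrib_left)
  then have "3 * ?S = (\<Sum>i\<in>?I. \<Sum>l\<in>?I. \<Sum>k\<in>?I. ?b i l k)"
    using S1 S2 by linarith
  also have "\<dots> = 0"
  proof (intro sum.neutral ballI)
    fix i l k assume "i \<in> ?I" "l \<in> ?I" "k \<in> ?I"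
    then have "?r i l k + ?r l k i + ?r k i l = 0"
      using X VF_F R_bianchi_234[of X "F i" "F l" "F k" p] R_skew_12[of X "F i" "F l" "F k" p]
        R_skew_12[of X "F l" "F k" "F i" p] R_skew_12[of X "F k" "F i" "F l" p] by simp
    then show "?b i l k = 0" by simp
  qed
  finally have S: "?S = 0" by simp
  have "(\<Sum>j\<in>?I. \<Sum>k\<in>?I. psi (F i) (F j) (F k) p * R (F i) X (\<Theta> (F j)) (F k) p)
      = - (\<Sum>l\<in>?I. \<Sum>k\<in>?I. ?\<Phi> i l k * ?r i l k)" if i: "i \<in> ?I" for i
  proof -
    \<comment> \<open>Transposing the skew matrix of \<open>\<theta>\<close> gives the sign and lets
      the sum over \<open>j\<close> be absorbed into \<open>?\<Phi>\<close>.\<close>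
    have "(\<Sum>j\<in>?I. \<Sum>k\<in>?I. psi (F i) (F j) (F k) p * R (F i) X (\<Theta> (F j)) (F k) p)
        = (\<Sum>j\<in>?I. \<Sum>k\<in>?I. \<Sum>l\<in>?I. - (?a l j * psi (F i) (F j) (F k) p * ?r i l k))"
    proof (intro sum.cong refl)
      fix j k assume jk: "j \<in> ?I" "k \<in> ?I"
      show "psi (F i) (F j) (F k) p * R (F i) X (\<Theta> (F j)) (F k) p
          = (\<Sum>l\<in>?I. - (?a l j * psi (F i) (F j) (F k) p * ?r i l k))"
        unfolding R\<Theta>[OF i jk] sum_distrib_left
        by (intro sum.cong refl) (simp add: a[OF jk(1)])
    qed
    also have "\<dots> = (\<Sum>l\<in>?I. \<Sum>j\<in>?I. \<Sum>k\<in>?I. - (?a l j * psi (F i) (F j) (F k) p * ?r i l k))"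
      by (rule rot[symmetric, of "\<lambda>j k l. - (?a l j * psi (F i) (F j) (F k) p * ?r i l k)"])
    also have "\<dots> = (\<Sum>l\<in>?I. \<Sum>k\<in>?I. \<Sum>j\<in>?I. - (?a l j * psi (F i) (F j) (F k) p * ?r i l k))"
      by (intro sum.cong refl sum.swap)
    also have "\<dots> = - (\<Sum>l\<in>?I. \<Sum>k\<in>?I. ?\<Phi> i l k * ?r i l k)"
      unfolding sum_negf[symmetric]
      by (intro sum.cong refl) (simp add: \<Phi>[OF i] sum_distrib_right sum_negf)
    finally show ?thesis .
  qed
  then show ?thesis using S by (simp add: sum_negf)
qed

text \<open>Exchanging \<open>j\<close> and \<open>k\<close> changes the sign of both factors, so
  the two halves of the commutator contribute equally.\<close>

lemma sum_psi_R_commutator: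
  assumes X: "VF X"
  shows "(\<Sum>i=1..m. \<Sum>j=1..m. \<Sum>k=1..m. psi (F i) (F j) (F k) p
      * (R (F i) X (\<Theta> (F j)) (F k) p + R (F i) X (F j) (\<Theta> (F k)) p)) = 0"
proof -
  let ?I = "{1..m}"
  have "(\<Sum>j\<in>?I. \<Sum>k\<in>?I. psi (F i) (F j) (F k) p * R (F i) X (F j) (\<Theta> (F k)) p)
      = (\<Sum>j\<in>?I. \<Sum>k\<in>?I. psi (F i) (F j) (F k) p * R (F i) X (\<Theta> (F j)) (F k) p)"
    if i: "i \<in> ?I" for i
  proof -
    have "(\<Sum>j\<in>?I. \<Sum>k\<in>?I. psi (F i) (F j) (F k) p * R (F i) X (F j) (\<Theta> (F k)) p)
        = (\<Sum>k\<in>?I. \<Sum>j\<in>?I. psi (F i) (F j) (F k) p * R (F i) X (F j) (\<Theta> (F k)) p)"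
      by (rule sum.swap)
    also have "\<dots> = (\<Sum>j\<in>?I. \<Sum>k\<in>?I. psi (F i) (F j) (F k) p * R (F i) X (\<Theta> (F j)) (F k) p)"
    proof (intro sum.cong refl)
      fix j k assume "j \<in> ?I" "k \<in> ?I"
      then show "psi (F i) (F k) (F j) p * R (F i) X (F k) (\<Theta> (F j)) p
          = psi (F i) (F j) (F k) p * R (F i) X (\<Theta> (F j)) (F k) p"
        using i X VF_F[of i] VF_F[of j] VF_F[of k] VF_Theta[of "F j"]
          psi_skew_23[of "F i" "F j" "F k" p] R_skew_34[of "F i" X "F k" "\<Theta> (F j)" p] by simp
    qed
    finally show ?thesis .
  qed
  then have "(\<Sum>i\<in>?I. \<Sum>j\<in>?I. \<Sum>k\<in>?I. psi (F i) (F j) (F k) p * R (F i) X (F j) (\<Theta> (F k)) p) = 0"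
    using sum_psi_R_Theta[OF X] by (simp only: cong: sum.cong)
  then show ?thesis using sum_psi_R_Theta[OF X]
    by (simp only: distrib_left sum.distrib add_0)
qed

end

end

theorem proposition4p2:
  fixes A :: "('m::{t2_space, second_countable_topology}, 'e::euclidean_space) atlas"
    and \<theta> :: "'m endo" and \<xi> :: "'m vfield" and \<eta> :: "'m oneform" and g :: "'m bilin"
    and D :: "'m connection"
    and X :: "'m vfield" and F E :: "nat \<Rightarrow> 'm vfield"
    and n :: nat and p :: 'm
  assumes "DIM('e) = 2 * n + 1"
    and "nearly_cosymplectic_manifold A \<theta> \<xi> \<eta> g D"
    and "orth_section A g \<xi> X"
    and "\<And>j. j \<in> {1..2 * n} \<Longrightarrow> orth_section A g \<xi> (F j)"
    and "orthonormal_basis_at A g \<xi> p (2 * n) (\<lambda>j. F j p)"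
    and "\<And>i. i \<in> {1..2 * n} \<Longrightarrow> E i = F i"
    and "E (2 * n + 1) = \<xi>"
  shows "(\<Sum>i=1..2 * n + 1. \<Sum>j=1..2 * n.
            g p (cov_deriv_endo (proj_connection g \<xi> D) (restr_endo A g \<xi> \<theta>) (E i) (F j) p)
                (curvature_commutator D \<theta> (E i) X (F j) p)) = 0"
proof -
  interpret nearly_cosymplectic A g D \<theta> \<xi> \<eta>
    using assms(2) by unfold_locales (simp_all add: nearly_cosymplectic_manifold_def)
  let ?I = "{1..2 * n}"
  let ?t = "\<lambda>Y j. g p (cov_deriv_endo (proj_connection g \<xi> D) (restr_endo A g \<xi> \<theta>) Y (F j) p)
                (curvature_commutator D \<theta> Y X (F j) p)"
  have X: "VF X" using assms(3) by (rule orth_VF)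
  have F: "VF (F j)" if "j \<in> ?I" for j using assms(4)[OF that] by (rule orth_VF)
  have t: "?t Y j = (\<Sum>k\<in>?I. psi Y (F j) (F k) p
      * (R Y X (\<Theta> (F j)) (F k) p + R Y X (F j) (\<Theta> (F k)) p))"
    if "VF Y" "j \<in> ?I" for Y j
    by (rule g_proj_cov_deriv[OF assms(4,5) that(1) X that(2)])
  have "(\<Sum>i\<in>?I. \<Sum>j\<in>?I. ?t (F i) j) = (\<Sum>i\<in>?I. \<Sum>j\<in>?I. \<Sum>k\<in>?I. psi (F i) (F j) (F k) p
      * (R (F i) X (\<Theta> (F j)) (F k) p + R (F i) X (F j) (\<Theta> (F k)) p))"
    by (intro sum.cong refl t F)
  also have "\<dots> = 0"
    by (rule sum_psi_R_commutator[OF assms(4,5) X])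
  finally have "(\<Sum>i\<in>?I. \<Sum>j\<in>?I. ?t (F i) j) = 0" .
  moreover have "(\<Sum>j\<in>?I. ?t \<xi> j) = 0"
  proof (intro sum.neutral ballI)
    fix j assume j: "j \<in> ?I"
    \<comment> \<open>All arguments after \<open>\<xi>\<close> lie in the distribution:
      \<open>X\<close> by hypothesis, the others because \<open>\<theta>\<close> maps into
      it.\<close>
    have "R \<xi> X (\<Theta> (F j)) (F k) p = 0" "R \<xi> X (F j) (\<Theta> (F k)) p = 0" if "k \<in> ?I" for k
      using assms(3,4) j that by (simp_all add: R_xi_orth orth_Theta F)
    then show "?t \<xi> j = 0" by (simp add: t[OF VF_xi j])
  qed
  ultimately show ?thesis using assms(6,7) by simp
qed

end
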